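(* Let $0 < \delta \le 1/6$ and let $p_1 \le p_2 \le \dots \le p_t$, $t \ge 2$, be primes satisfying the three conditions: (i) $p_2 \ge 3$; (ii) $n := \prod_{i=1}^t p_i \ge n(\delta)$; (iii) $p_1 \le \frac{1}{3C(\delta)} \sqrt{n/\log n}$. Let $G$ be an abelian group of order $n$ and let $A$ be an incomplete subset of $G$ with $|A| \ge \left(\frac{5}{6}+\delta\right)\frac{n}{p_1}$. Then $A$ is nice, and there is a subgroup $H$ of $G$ such that $n/|H|$ is one of the primes $p_i$, $|A \setminus H| < 3p_1$, and $S_{A \cap H} = H$.
   Context: Groups are written additively. For a subset $A$ of an abelian group $G$, $S_A := \{\sum_{a\in B} a : \emptyset \ne B \subset A,\ |B|<\infty\}$ is the set of all sums of (finitely many, at least one) distinct elements of $A$. $A$ is complete if $S_A = G$ and incomplete otherwise. A subset $A$ of a finite abelian group $G$ is nice if there is a subgroup $H$ of $G$ such that $|G/H|$ is a prime and $S_{A\cap H} = H$. All logarithms are natural. For $0<\epsilon\le 1$, define $C(\epsilon) := \sqrt{\frac{40/\epsilon^2}{\log(2/\epsilon)}}$, and let $n(\epsilon)$ be the smallest integer $m$ such that for every integer $n \ge m$ one has $n \ge C(\epsilon)\sqrt{n\log n} > \frac{4}{\epsilon^2}$. *)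

theory Defs
  imports
    Complex_Main
    "HOL-Computational_Algebra.Primes"
    "HOL-Algebra.Coset"
    "HOL-Algebra.FiniteProduct"
begin

text \<open>
  Abelian groups are rendered by the locale \<open>comm_group\<close>, whose notation is multiplicative; the
  group operation, \<open>finprod\<close> and \<open>Mod\<close> play the role of addition, finite sums and the quotient.
\<close>

definition subset_sums :: "('a, 'b) monoid_scheme \<Rightarrow> 'a set \<Rightarrow> 'a set" where
  "subset_sums G A = {finprod G (\<lambda>a. a) B | B. B \<noteq> {} \<and> B \<subseteq> A \<and> finite B}"

definition complete_subset :: "('a, 'b) monoid_scheme \<Rightarrow> 'a set \<Rightarrow> bool" where
  "complete_subset G A \<longleftrightarrow> subset_sums G A = carrier G"

abbreviation incomplete_subset :: "('a, 'b) monoid_scheme \<Rightarrow> 'a set \<Rightarrow> bool" where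
  "incomplete_subset G A \<equiv> \<not> complete_subset G A"

text \<open>The following is only meaningful for subsets of the carrier of a finite abelian group.\<close>

definition nice :: "('a, 'b) monoid_scheme \<Rightarrow> 'a set \<Rightarrow> bool" where
  "nice G A \<longleftrightarrow>
     (\<exists>H. subgroup H G \<and> Factorial_Ring.prime (order (G Mod H)) \<and> subset_sums G (A \<inter> H) = H)"

definition C_eps :: "real \<Rightarrow> real" where
  "C_eps \<epsilon> = sqrt ((40 / \<epsilon>\<^sup>2) / ln (2 / \<epsilon>))"

text \<open>
  Taking the least natural number instead of the least integer changes nothing: the strict
  inequality with \<open>4 / \<epsilon>\<^sup>2 > 0\<close> forces \<open>k > 0\<close>. For \<open>0 < \<epsilon> \<le> 1\<close> the required \<open>m\<close> exists since
  \<open>sqrt (k * ln k)\<close> tends to infinity but is of smaller order than \<open>k\<close>.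
\<close>

definition n_eps :: "real \<Rightarrow> nat" where
  "n_eps \<epsilon> = (LEAST m. \<forall>k\<ge>m. real k \<ge> C_eps \<epsilon> * sqrt (real k * ln (real k)) \<and>
                             C_eps \<epsilon> * sqrt (real k * ln (real k)) > 4 / \<epsilon>\<^sup>2)"

end

theory Submission
  imports Defs
begin

text \<open>
  Put \<open>N = n / p\<^sub>1\<close>; the size condition on \<open>p\<^sub>1\<close> gives \<open>N \<ge> 1080 p\<^sub>1\<close>. If every proper subgroup
  contains at most \<open>N / 2 + 1\<close> elements of \<open>A\<close>, then \<open>A\<close> is complete: as long as a set \<open>B\<close> of subset
  sums has at most \<open>n / 2\<close> elements, Olson's averaging argument over balls in the Cayley graph of the
  unused part of \<open>A\<close> (which still generates \<open>G\<close>) yields an unused element whose translate of \<open>B\<close>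
  adds at least \<open>N / 48\<close> or so new elements, so that two disjoint small parts of \<open>A\<close> each have more
  than \<open>n / 2\<close> subset sums. Hence some proper subgroup \<open>H\<close> contains more than \<open>N / 2 + 1\<close> elements
  of \<open>A\<close>. Its index is less than \<open>2 p\<^sub>1\<close>, hence prime, and so \<open>|H| \<le> N\<close>; every element of \<open>H\<close> is
  then a sum of two distinct elements of \<open>A \<inter> H\<close>, because \<open>4\<close> does not divide \<open>n\<close>. Finally, if
  \<open>A\<close> had at least \<open>|G / H| - 1\<close> elements outside \<open>H\<close>, their subset sums would meet every coset
  of \<open>H\<close>.
\<close>

subsection \<open>Growth of a set under translation\<close>

context group
begin

lemma card_r_coset:
  assumes "M \<subseteq> carrier G" "x \<in> carrier G"
  shows "card (M #> x) = card M"
proof -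
  have "M #> x = (\<lambda>m. m \<otimes> x) ` M"
    by (auto simp: r_coset_def)
  moreover have "inj_on (\<lambda>m. m \<otimes> x) M"
    using assms by (auto intro!: inj_onI simp: subset_iff)
  ultimately show ?thesis
    by (simp add: card_image)
qed

lemma finite_r_coset: "finite M \<Longrightarrow> finite (M #> x)"
  by (auto simp: r_coset_def)

lemma r_coset_eqI:
  assumes "finite T" "T \<subseteq> carrier G" "x \<in> carrier G" "T #> x \<subseteq> T"
  shows "T #> x = T"
  using assms by (intro card_subset_eq) (auto simp: card_r_coset)

text \<open>Serves to show that a set stable under enough translations is the whole group: first a
  ball that has stopped growing, later a union of cosets of a maximal subgroup.\<close>

lemma subgroup_stabilizer:
  assumes "finite T" "T \<subseteq> carrier G"
  shows "subgroup {g \<in> carrier G. T #> g = T} G"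
proof (rule subgroupI)
  show "{g \<in> carrier G. T #> g = T} \<noteq> {}"
    using assms by (auto intro!: exI[of _ \<one>] simp: coset_mult_one)
next
  fix g assume "g \<in> {g \<in> carrier G. T #> g = T}"
  then have g: "g \<in> carrier G" "T #> g = T" by auto
  then have "T #> inv g = (T #> g) #> inv g" by simp
  also have "\<dots> = T"
    using assms g(1) by (simp add: coset_mult_assoc coset_mult_one)
  finally show "inv g \<in> {g \<in> carrier G. T #> g = T}"
    using g by simp
next
  fix g h assume "g \<in> {g \<in> carrier G. T #> g = T}" "h \<in> {g \<in> carrier G. T #> g = T}"
  then show "g \<otimes> h \<in> {g \<in> carrier G. T #> g = T}"
    using assms(2) by (auto simp: coset_mult_assoc[symmetric])
qed auto

text \<open>Double counting: \<open>c\<close> in \<open>B #> y\<close> and in \<open>B\<close> gives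
  the pair \<open>(c \<otimes> inv y, c)\<close> of elements of \<open>B\<close>, from which
  \<open>y\<close> can be recovered.\<close>

lemma card_inter_r_coset_sum_le:
  assumes "finite B" "finite T" "B \<subseteq> carrier G" "T \<subseteq> carrier G"
  shows "(\<Sum>y\<in>T. card ((B #> y) \<inter> B)) \<le> card B * card B"
proof -
  define P where "P = Sigma T (\<lambda>y. (B #> y) \<inter> B)"
  have fin: "\<And>y. finite ((B #> y) \<inter> B)"
    using assms(1) by simp
  have "(\<Sum>y\<in>T. card ((B #> y) \<inter> B)) = card P"
    unfolding P_def using assms(2) fin by (subst card_SigmaI) auto
  also have "\<dots> \<le> card (B \<times> B)"
  proof (rule card_inj_on_le[of "\<lambda>(y, c). (c \<otimes> inv y, c)"])
    show "inj_on (\<lambda>(y, c). (c \<otimes> inv y, c)) P"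
    proof -
      have "y = y'" if "(y, c) \<in> P" "(y', c) \<in> P" "c \<otimes> inv y = c \<otimes> inv y'" for y y' c
      proof -
        have "y \<in> carrier G" "y' \<in> carrier G" "c \<in> carrier G"
          using that assms(3,4) by (auto simp: P_def)
        with that(3) show ?thesis
          by (metis Units_eq Units_l_cancel inv_closed inv_inv)
      qed
      then show ?thesis by (auto intro!: inj_onI)
    qed
    show "(\<lambda>(y, c). (c \<otimes> inv y, c)) ` P \<subseteq> B \<times> B"
      using assms(3,4) by (auto simp: P_def r_coset_def m_assoc subset_iff)
    show "finite (B \<times> B)" using assms(1) by simp
  qed
  finally show ?thesis
    by (simp add: card_cartesian_product)
qed

text \<open>Averaging: the overlaps of \<open>B\<close> with its translates by \<open>T\<close> sum
  to at most \<open>|B|^2\<close>, so over at least \<open>2 |B|\<close> translates their mean is at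
  most \<open>|B| / 2\<close>.\<close>

lemma exists_large_shift:
  assumes "finite B" "finite T" "B \<subseteq> carrier G" "T \<subseteq> carrier G"
    and "T \<noteq> {}" and "2 * card B \<le> card T"
  shows "\<exists>y\<in>T. card B \<le> 2 * card ((B #> y) - B)"
proof (rule ccontr)
  assume "\<not> ?thesis"
  then have small: "2 * card ((B #> y) - B) < card B" if "y \<in> T" for y
    using that by (auto simp: not_le)
  \<comment> \<open>The \<open>+ 1\<close> comes from the strict inequality in \<open>small\<close>;
    it is what makes the summed bounds contradictory when
    \<open>card T = 2 * card B\<close>.\<close>
  have "card B + 1 \<le> 2 * card ((B #> y) \<inter> B)" if "y \<in> T" for y
  proof -
    have "card (B #> y) = card ((B #> y) - B) + card ((B #> y) \<inter> B)"
      using assms(1) by (subst card_Un_disjoint[symmetric]) (auto simp: finite_r_coset intro: arg_cong[where f = card])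
    moreover have "card (B #> y) = card B"
      using that assms by (intro card_r_coset) auto
    ultimately show ?thesis
      using small[OF that] by linarith
  qed
  then have "(\<Sum>y\<in>T. card B + 1) \<le> (\<Sum>y\<in>T. 2 * card ((B #> y) \<inter> B))"
    by (intro sum_mono) auto
  also have "\<dots> \<le> 2 * (card B * card B)"
    using card_inter_r_coset_sum_le[OF assms(1-4)] by (simp add: sum_distrib_left[symmetric])
  finally have "card T * (card B + 1) \<le> 2 * card B * card B"
    by simp
  also have "\<dots> \<le> card T * card B"
    using assms(6) by simp
  finally show False
    using assms(2,5) by simp
qed

text \<open>For \<open>b\<close> in \<open>B\<close> with \<open>b \<otimes> x \<otimes> y\<close>
  outside \<open>B\<close>, either \<open>b \<otimes> x\<close> is already outside \<open>B\<close>,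
  or it lies in \<open>B\<close> and the translation by \<open>y\<close> alone leaves
  \<open>B\<close>.\<close>

lemma card_shift_mult_le:
  assumes "finite B" "B \<subseteq> carrier G" "x \<in> carrier G" "y \<in> carrier G"
  shows "card ((B #> (x \<otimes> y)) - B) \<le> card ((B #> x) - B) + card ((B #> y) - B)"
proof -
  have "(B #> (x \<otimes> y)) - B \<subseteq> (((B #> x) - B) #> y) \<union> ((B #> y) - B)"
    using assms by (auto simp: r_coset_def m_assoc[symmetric] subset_iff)
  then have "card ((B #> (x \<otimes> y)) - B) \<le> card ((((B #> x) - B) #> y) \<union> ((B #> y) - B))"
    using assms(1) by (intro card_mono) (auto simp: finite_r_coset)
  also have "\<dots> \<le> card (((B #> x) - B) #> y) + card ((B #> y) - B)"
    by (rule card_Un_le)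
  also have "card (((B #> x) - B) #> y) = card ((B #> x) - B)"
    using assms r_coset_subset_G[OF assms(2,3)] by (intro card_r_coset) auto
  finally show ?thesis .
qed

text \<open>Translating the new elements of \<open>B #> inv x\<close> by \<open>x\<close> gives
  \<open>B - (B #> x)\<close>, which is as large as \<open>(B #> x) - B\<close> because
  \<open>B\<close> and \<open>B #> x\<close> have equal size.\<close>

lemma card_shift_inv:
  assumes "finite B" "B \<subseteq> carrier G" "x \<in> carrier G"
  shows "card ((B #> inv x) - B) = card ((B #> x) - B)"
proof -
  have "((B #> inv x) - B) #> x = B - (B #> x)"
  proof (intro equalityI subsetI)
    fix z assume "z \<in> ((B #> inv x) - B) #> x"
    then obtain b where b: "b \<in> B" "b \<otimes> inv x \<notin> B" "z = b \<otimes> inv x \<otimes> x"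
      by (auto simp: r_coset_def)
    then have "z = b" using assms by (auto simp: m_assoc)
    moreover have "b \<notin> B #> x"
    proof
      assume "b \<in> B #> x"
      then obtain c where "c \<in> B" "b = c \<otimes> x" by (auto simp: r_coset_def)
      with b(2) show False
        using assms by (auto simp: m_assoc subset_iff)
    qed
    ultimately show "z \<in> B - (B #> x)" using b by auto
  next
    fix z assume z: "z \<in> B - (B #> x)"
    then have "z \<otimes> inv x \<notin> B"
      using assms by (force simp: r_coset_def m_assoc subset_iff)
    moreover have "z = z \<otimes> inv x \<otimes> x"
      using z assms by (auto simp: m_assoc subset_iff)
    ultimately show "z \<in> ((B #> inv x) - B) #> x"
      using z unfolding r_coset_def by blast
  qed
  moreover have "card (((B #> inv x) - B) #> x) = card ((B #> inv x) - B)"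
    using assms r_coset_subset_G[of B "inv x"] by (intro card_r_coset) auto
  moreover have "card (B - (B #> x)) = card ((B #> x) - B)"
    using assms card_r_coset[of B x]
    by (simp add: card_le_sym_Diff finite_r_coset order_antisym)
  ultimately show ?thesis by simp
qed

end

section \<open>Balls in Cayley graphs and Olson's growth argument\<close>

text \<open>For \<open>S\<close> containing the identity and closed under inverses, this is the ball
  of radius \<open>k\<close> around the identity in the Cayley graph of \<open>S\<close>.\<close>

primrec set_power :: "('a, 'b) monoid_scheme \<Rightarrow> 'a set \<Rightarrow> nat \<Rightarrow> 'a set" where
  "set_power G S 0 = {\<one>\<^bsub>G\<^esub>}"
| "set_power G S (Suc k) = set_power G S k <#>\<^bsub>G\<^esub> S"

context group
begin

lemma set_power_closed: "S \<subseteq> carrier G \<Longrightarrow> set_power G S k \<subseteq> carrier G"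
  by (induction k) (auto simp: set_mult_closed)

lemma set_power_Suc_mono:
  assumes "S \<subseteq> carrier G" "\<one> \<in> S"
  shows "set_power G S k \<subseteq> set_power G S (Suc k)"
proof
  fix x assume x: "x \<in> set_power G S k"
  then have "x = x \<otimes> \<one>"
    using set_power_closed[OF assms(1), of k] by (simp add: subset_iff)
  then show "x \<in> set_power G S (Suc k)"
    using x assms(2) by (auto simp: set_mult_def)
qed

text \<open>In the Cayley graph of \<open>S\<close>, the unit ball around a point at distance \<open>3 j + 3\<close> from the
  identity is disjoint from the ball of radius \<open>3 j + 1\<close>.\<close>

lemma card_set_power:
  assumes fin: "finite (carrier G)" and S: "S \<subseteq> carrier G" "\<one> \<in> S" "\<And>x. x \<in> S \<Longrightarrow> inv x \<in> S"
    and gen: "\<And>H. subgroup H G \<Longrightarrow> S \<subseteq> H \<Longrightarrow> H = carrier G"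
  shows "set_power G S (3 * j + 1) = carrier G \<or>
         (j + 1) * card S \<le> card (set_power G S (3 * j + 1))"
proof (induction j)
  case 0
  have "set_power G S 1 = S"
    using S(1) by (auto simp: set_mult_def subset_iff)
  then show ?case by simp
next
  case (Suc j)
  let ?b = "set_power G S"
  note sub = set_power_closed[OF S(1)] and mono = set_power_Suc_mono[OF S(1,2)]
  have finb: "finite (?b k)" for k
    using sub fin by (rule finite_subset)
  have e: "3 * Suc j + 1 = Suc (Suc (Suc (3 * j + 1)))" by simp
  define r where "r = 3 * j + 1"
  have mono2: "?b (Suc k) \<subseteq> ?b (Suc (Suc (Suc k)))" for k
    using mono[of "Suc k"] mono[of "Suc (Suc k)"] by (rule order_trans)
  have mono3: "?b k \<subseteq> ?b (Suc (Suc (Suc k)))" for k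
    using mono mono2 by (rule order_trans)
  show ?case
  proof (cases "?b (Suc (Suc r)) = ?b (Suc r)")
    case True
    \<comment> \<open>A ball that stops growing is stable under translation by each element of
      \<open>S\<close>, so by \<open>gen\<close> its stabilizer is \<open>G\<close>; since it
      contains the identity, it equals \<open>G\<close>.\<close>
    let ?K = "{g \<in> carrier G. ?b (Suc r) #> g = ?b (Suc r)}"
    have "S \<subseteq> ?K"
    proof
      fix x assume x: "x \<in> S"
      then have "?b (Suc r) #> x \<subseteq> ?b (Suc (Suc r))"
        by (auto simp: r_coset_def set_mult_def)
      then show "x \<in> ?K"
        using True x S(1) r_coset_eqI[OF finb sub, of x "Suc r"] by auto
    qed
    then have K: "?K = carrier G"
      by (intro gen subgroup_stabilizer finb sub)
    have one: "\<one> \<in> ?b k" for k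
      by (induction k) (use mono in auto)
    have "carrier G \<subseteq> ?b (Suc r)"
    proof
      fix g assume g: "g \<in> carrier G"
      have "\<one> \<otimes> g \<in> ?b (Suc r) #> g"
        using one[of "Suc r"] unfolding r_coset_def by blast
      also have "\<dots> = ?b (Suc r)" using g K by blast
      finally show "g \<in> ?b (Suc r)" using g by simp
    qed
    then have "?b (Suc (Suc (Suc r))) = carrier G"
      using mono2 sub by (meson order_antisym order_trans)
    then show ?thesis unfolding e r_def by blast
  next
    case False
    then obtain y where y: "y \<in> ?b (Suc (Suc r))" "y \<notin> ?b (Suc r)"
      using mono[of "Suc r"] by blast
    have yc: "y \<in> carrier G" using y(1) sub[of "Suc (Suc r)"] by blast
    have "?b r \<inter> (y <# S) = {}"
    proof (rule ccontr)
      assume "?b r \<inter> (y <# S) \<noteq> {}"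
      then obtain x where x: "x \<in> S" "y \<otimes> x \<in> ?b r"
        by (auto simp: l_coset_def)
      then have "y \<otimes> x \<otimes> inv x \<in> ?b (Suc r)"
        using S(3) by (auto simp: set_mult_def)
      moreover have "y \<otimes> x \<otimes> inv x = y"
        using x S(1) yc by (auto simp: m_assoc subset_iff)
      ultimately show False using y(2) by simp
    qed
    moreover have "y <# S \<subseteq> ?b (Suc (Suc (Suc r)))"
      using y(1) by (auto simp: l_coset_def set_mult_def)
    ultimately have "card (?b r) + card (y <# S) \<le> card (?b (Suc (Suc (Suc r))))"
      using finb mono3 by (metis card_Un_disjoint card_mono finite_subset le_sup_iff)
    moreover have "card (y <# S) = card S"
    proof -
      have "y <# S = (\<lambda>s. y \<otimes> s) ` S" by (auto simp: l_coset_def)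
      moreover have "inj_on (\<lambda>s. y \<otimes> s) S"
        using S(1) yc by (auto intro!: inj_onI simp: subset_iff)
      ultimately show ?thesis by (simp add: card_image)
    qed
    moreover have "?b (Suc (Suc (Suc r))) = carrier G" if "?b r = carrier G"
      using that mono3[of r] sub by (metis order_antisym)
    ultimately show ?thesis
      using Suc.IH unfolding e r_def[symmetric] by auto
  qed
qed

text \<open>If every translate by an element of \<open>S\<close> added at most \<open>L\<close> elements, then by subadditivity
  a translate by an element of the ball of radius \<open>k\<close> would add at most \<open>k L\<close>; this contradicts
  \<open>exists_large_shift\<close> for the first ball of the form above with at least \<open>2 |B|\<close> elements.\<close>

lemma exists_growing_shift:
  assumes fin: "finite (carrier G)" and S: "S \<subseteq> carrier G" "s \<le> card S" "0 < s"
    and gen: "\<And>H. subgroup H G \<Longrightarrow> S \<subseteq> H \<Longrightarrow> H = carrier G"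
    and B: "B \<subseteq> carrier G" "s \<le> 6 * card B" "2 * card B \<le> order G"
  shows "\<exists>x\<in>S. s \<le> 24 * card ((B #> x) - B)"
proof (rule ccontr)
  assume "\<not> ?thesis"
  then have small: "24 * card ((B #> x) - B) < s" if "x \<in> S" for x
    using that by (auto simp: not_le)
  \<comment> \<open>The largest integer with \<open>24 * L < s\<close>.\<close>
  define L where "L = (s - 1) div 24"
  have L: "card ((B #> x) - B) \<le> L" if "x \<in> S" for x
    using small[OF that] by (simp add: L_def)
  have L24: "24 * L < s" using S(3) by (simp add: L_def)
  have finB: "finite B" using B(1) fin by (rule finite_subset)
  \<comment> \<open>Symmetrizing makes the ball estimate applicable and keeps the bound
    \<open>L\<close>, since inverse translations add equally many elements.\<close>
  define S' where "S' = insert \<one> (S \<union> (\<lambda>x. inv x) ` S)"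
  have S': "S' \<subseteq> carrier G" "\<one> \<in> S'" "S \<subseteq> S'"
    using S(1) by (auto simp: S'_def)
  have S'_inv: "inv x \<in> S'" if "x \<in> S'" for x
    using that S(1) by (auto simp: S'_def)
  have cS': "s \<le> card S'"
    using S(2) card_mono[OF finite_subset[OF S'(1) fin] S'(3)] by linarith
  have LS': "card ((B #> x) - B) \<le> L" if "x \<in> S'" for x
    using that L S(1) finB B(1) by (auto simp: S'_def coset_mult_one card_shift_inv subset_iff)
  have Lk: "card ((B #> y) - B) \<le> k * L" if "y \<in> set_power G S' k" for y k
    using that
  proof (induction k arbitrary: y)
    case 0
    then show ?case using B(1) by (simp add: coset_mult_one)
  next
    case (Suc k)
    then obtain z x where zx: "z \<in> set_power G S' k" "x \<in> S'" "y = z \<otimes> x"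
      by (auto simp: set_mult_def)
    then have "card ((B #> y) - B) \<le> card ((B #> z) - B) + card ((B #> x) - B)"
      using card_shift_mult_le[OF finB B(1), of z x] subsetD[OF set_power_closed[OF S'(1)]] S'(1)
      by auto
    then show ?case
      using Suc.IH[OF zx(1)] LS'[OF zx(2)] by simp
  qed
  \<comment> \<open>With this \<open>j\<close> one has
    \<open>j * s \<le> 2 * card B \<le> (j + 1) * s\<close>: the ball of radius
    \<open>3 j + 1\<close> has at least \<open>2 |B|\<close> elements, and the radius is still of
    order \<open>|B| / s\<close>.\<close>
  define j where "j = 2 * card B div s"
  define T where "T = set_power G S' (3 * j + 1)"
  have js: "j * s \<le> 2 * card B" by (simp add: j_def)
  have js1: "2 * card B \<le> (j + 1) * s"
    using S(3) by (simp add: j_def less_imp_le_nat dividend_less_div_times)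
  have "T = carrier G \<or> (j + 1) * card S' \<le> card T"
    unfolding T_def by (intro card_set_power fin S'(1,2) S'_inv gen) (use S'(3) in auto)
  then have "2 * card B \<le> card T"
  proof
    assume "T = carrier G"
    then show ?thesis using B(3) by (simp add: order_def)
  next
    assume "(j + 1) * card S' \<le> card T"
    moreover have "(j + 1) * s \<le> (j + 1) * card S'"
      using cS' by (rule mult_le_mono2)
    ultimately show ?thesis using js1 by linarith
  qed
  moreover have Tc: "T \<subseteq> carrier G"
    unfolding T_def by (rule set_power_closed[OF S'(1)])
  moreover have "0 < card B" using B(2) S(3) by linarith
  ultimately obtain y where "y \<in> T" "card B \<le> 2 * card ((B #> y) - B)"
    using exists_large_shift[OF finB finite_subset[OF Tc fin] B(1) Tc] by fastforce
  then have "card B \<le> 2 * ((3 * j + 1) * L)"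
    using Lk[of y "3 * j + 1"] unfolding T_def by linarith
  \<comment> \<open>Scaled so that \<open>24 * L < s\<close> applies; the chain ends in
    \<open>12 |B| < 6 |B| + s\<close>, contrary to \<open>s \<le> 6 * card B\<close>.\<close>
  then have "12 * card B \<le> (3 * j + 1) * (24 * L)"
    by (simp add: algebra_simps)
  also have "\<dots> < (3 * j + 1) * s"
    using L24 by (intro mult_less_mono2) auto
  also have "\<dots> \<le> 6 * card B + s" using js by (simp add: algebra_simps)
  finally show False using B(2) by linarith
qed

end

subsection \<open>Subset sums\<close>

lemma (in group) inv_eqD: "inv x = inv y \<Longrightarrow> x \<in> carrier G \<Longrightarrow> y \<in> carrier G \<Longrightarrow> x = y"
  by (metis inv_inv)

text \<open>Lagrange twice: the index of \<open>H\<close> is the index of \<open>K\<close> in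
  \<open>G\<close> times the index of \<open>H\<close> in \<open>K\<close>, and a prime forces one
  factor to be 1.\<close>

lemma (in group) prime_index_maximal:
  assumes "finite (carrier G)" "subgroup H G" "subgroup K G" "H \<subseteq> K"
    and "Factorial_Ring.prime m" "order G = m * card H"
  shows "K = H \<or> K = carrier G"
proof -
  interpret K: group "G\<lparr>carrier := K\<rparr>"
    using assms(3) by (rule subgroup_imp_group)
  have "subgroup H (G\<lparr>carrier := K\<rparr>)"
    using assms(2-4) by (rule subgroup_incl)
  then have "card (rcosets\<^bsub>G\<lparr>carrier := K\<rparr>\<^esub> H) * card H = card K"
    using K.lagrange[of H] by (simp add: order_def)
  then obtain j where j: "card K = j * card H"
    by (rule that[OF sym])
  obtain l where l: "order G = l * card K"
    using lagrange[OF assms(3)] by (rule that[OF sym])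
  have KG: "K \<subseteq> carrier G"
    using assms(3) by (rule subgroup.subset)
  then have finK: "finite K"
    using assms(1) by (rule finite_subset)
  have "card H > 0"
    using finite_subset[OF assms(4) finK] subgroup.one_closed[OF assms(2)] card_gt_0_iff by blast
  then have "m = l * j" using assms(6) j l by simp
  then have "j = 1 \<or> l = 1"
    using assms(5) by (metis prime_product)
  then show ?thesis
  proof
    assume "j = 1"
    then have "H = K" using assms(4) finK j by (intro card_subset_eq) auto
    then show ?thesis by simp
  next
    assume "l = 1"
    then have "K = carrier G"
      using assms(1) KG l by (intro card_subset_eq) (auto simp: order_def)
    then show ?thesis by simp
  qed
qed

context comm_group
begin

lemma subset_sums_subset_subgroup:
  assumes "subgroup H G" "A \<subseteq> H"
  shows "subset_sums G A \<subseteq> H"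
proof -
  have "finprod G (\<lambda>a. a) B \<in> H" if "finite B" "B \<subseteq> H" for B
    using that
  proof (induction B rule: finite_induct)
    case empty
    then show ?case by (simp add: subgroup.one_closed[OF assms(1)])
  next
    case (insert x B)
    then have "insert x B \<subseteq> carrier G"
      using subgroup.subset[OF assms(1)] by blast
    with insert show ?case
      by (auto simp: subgroup.m_closed[OF assms(1)] subset_iff)
  qed
  with assms(2) show ?thesis by (auto simp: subset_sums_def)
qed

lemma subset_sums_closed: "A \<subseteq> carrier G \<Longrightarrow> subset_sums G A \<subseteq> carrier G"
  by (rule subset_sums_subset_subgroup[OF subgroup_self])

lemma subset_sums_mono: "A \<subseteq> B \<Longrightarrow> subset_sums G A \<subseteq> subset_sums G B"
  unfolding subset_sums_def by blast

lemma subset_subset_sums: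
  assumes "A \<subseteq> carrier G"
  shows "A \<subseteq> subset_sums G A"
proof
  fix a assume "a \<in> A"
  with assms have "finprod G (\<lambda>a. a) {a} = a" by auto
  with \<open>a \<in> A\<close> show "a \<in> subset_sums G A"
    unfolding subset_sums_def by (intro CollectI exI[of _ "{a}"]) auto
qed

lemma subset_sums_mult:
  assumes "A \<subseteq> carrier G" "B \<subseteq> carrier G" "A \<inter> B = {}"
    and "x \<in> subset_sums G A" "y \<in> subset_sums G B"
  shows "x \<otimes> y \<in> subset_sums G (A \<union> B)"
proof -
  obtain C where C: "C \<noteq> {}" "C \<subseteq> A" "finite C" "x = finprod G (\<lambda>a. a) C"
    using assms(4) by (auto simp: subset_sums_def)
  obtain D where D: "D \<noteq> {}" "D \<subseteq> B" "finite D" "y = finprod G (\<lambda>a. a) D"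
    using assms(5) by (auto simp: subset_sums_def)
  have "x \<otimes> y = finprod G (\<lambda>a. a) (C \<union> D)"
    using C D assms(1-3) by (subst finprod_Un_disjoint) auto
  then show ?thesis
    using C D unfolding subset_sums_def by (intro CollectI exI[of _ "C \<union> D"]) auto
qed

section \<open>Completeness of sets not concentrated on a proper subgroup\<close>

lemma exists_large_subset_sums:
  assumes fin: "finite (carrier G)" and X: "X \<subseteq> carrier G"
    and spread: "\<And>H. subgroup H G \<Longrightarrow> H \<noteq> carrier G \<Longrightarrow> v + w < card (X - H)"
    and s: "s + (v + w) \<le> card X" "0 < s" "s \<le> 6 * v" and w: "12 * order G < w * s"
  shows "\<exists>U\<subseteq>X. card U \<le> v + w \<and> order G < 2 * card (subset_sums G U)"
proof -
  have finX: "finite X" using X fin by (rule finite_subset)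
  have fins: "finite (subset_sums G U)" if "U \<subseteq> X" for U
    using that X subset_sums_closed[of U] fin by (meson finite_subset order_trans)
  \<comment> \<open>The size of \<open>U\<close> is bounded rather than fixed, so that the process
    may halt once the sums exceed half the group.\<close>
  have "\<exists>U\<subseteq>X. v \<le> card U \<and> card U \<le> v + i \<and>
          (order G < 2 * card (subset_sums G U) \<or> i * s \<le> 24 * card (subset_sums G U))"
    if "i \<le> w" for i
    using that
  proof (induction i)
    case 0
    obtain U where "U \<subseteq> X" "card U = v"
      using s(1) by (meson add_leD2 add_leD1 obtain_subset_with_card_n)
    then show ?case by auto
  next
    case (Suc i)
    then obtain U where U: "U \<subseteq> X" "v \<le> card U" "card U \<le> v + i"
      and large: "order G < 2 * card (subset_sums G U) \<or> i * s \<le> 24 * card (subset_sums G U)"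
      by auto
    show ?case
    proof (cases "order G < 2 * card (subset_sums G U)")
      case True
      with U show ?thesis by (intro exI[of _ U]) auto
    next
      case False
      let ?B = "subset_sums G U"
      have Uc: "U \<subseteq> carrier G" using U(1) X by blast
      have B: "?B \<subseteq> carrier G" using subset_sums_closed[OF Uc] .
      have "card U \<le> card ?B"
        using subset_subset_sums[OF Uc] fins[OF U(1)] by (rule card_mono[rotated])
      have "\<exists>x\<in>X - U. s \<le> 24 * card ((?B #> x) - ?B)"
      proof (rule exists_growing_shift[OF fin])
        show "s \<le> card (X - U)"
          using card_Diff_subset[of U X] finite_subset[OF U(1) finX] U s(1) Suc.prems by simp
        show "s \<le> 6 * card ?B" using s(3) U(2) \<open>card U \<le> card ?B\<close> by linarith
        show "2 * card ?B \<le> order G" using False by simp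
        fix H assume H: "subgroup H G" "X - U \<subseteq> H"
        show "H = carrier G"
        proof (rule ccontr)
          assume "H \<noteq> carrier G"
          then have "v + w < card (X - H)" using spread H(1) by blast
          also have "\<dots> \<le> card U"
            using H(2) finite_subset[OF U(1) finX] by (intro card_mono) auto
          finally show False using U(3) Suc.prems by simp
        qed
      qed (use X s(2) B in auto)
      then obtain x where x: "x \<in> X" "x \<notin> U" "s \<le> 24 * card ((?B #> x) - ?B)"
        by blast
      have xs: "x \<in> subset_sums G {x}"
        using x(1) X subset_subset_sums[of "{x}"] by auto
      have "?B #> x \<subseteq> subset_sums G (insert x U)"
        using subset_sums_mult[OF Uc, of "{x}" _ x] xs x X by (auto simp: r_coset_def)
      moreover have "?B \<subseteq> subset_sums G (insert x U)"
        by (rule subset_sums_mono) auto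
      ultimately have "card (?B \<union> ((?B #> x) - ?B)) \<le> card (subset_sums G (insert x U))"
        using x(1) U(1) by (intro card_mono fins) auto
      then have "card ?B + card ((?B #> x) - ?B) \<le> card (subset_sums G (insert x U))"
        using fins[OF U(1)] by (subst (asm) card_Un_disjoint) (auto simp: finite_r_coset)
      then have "Suc i * s \<le> 24 * card (subset_sums G (insert x U))"
        using x(3) large False by simp
      moreover have "card (insert x U) = Suc (card U)"
        using x(2) finite_subset[OF U(1) finX] by simp
      ultimately show ?thesis
        using U x(1) by (intro exI[of _ "insert x U"]) auto
    qed
  qed
  from this[of w] obtain U where "U \<subseteq> X" "card U \<le> v + w"
    "order G < 2 * card (subset_sums G U) \<or> w * s \<le> 24 * card (subset_sums G U)"
    by auto
  with w show ?thesis by (intro exI[of _ U]) auto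
qed

text \<open>Two disjoint parts of \<open>A\<close> with more than \<open>order G / 2\<close> sums
  each suffice: for every \<open>g\<close>, the sums of one part and the quotients of
  \<open>g\<close> by the sums of the other must meet.\<close>

lemma subset_sums_eq_carrier:
  assumes fin: "finite (carrier G)" and A: "A \<subseteq> carrier G"
    and spread: "\<And>H. subgroup H G \<Longrightarrow> H \<noteq> carrier G \<Longrightarrow> 2 * (v + w) < card (A - H)"
    and s: "s + 2 * (v + w) \<le> card A" "0 < s" "s \<le> 6 * v" and w: "12 * order G < w * s"
  shows "subset_sums G A = carrier G"
proof -
  have finA: "finite A" using A fin by (rule finite_subset)
  have "\<exists>U\<subseteq>A. card U \<le> v + w \<and> order G < 2 * card (subset_sums G U)"
    by (rule exists_large_subset_sums[OF fin A _ _ s(2,3) w]) (use spread s(1) in fastforce)+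
  then obtain U where U: "U \<subseteq> A" "card U \<le> v + w" "order G < 2 * card (subset_sums G U)"
    by blast
  have finU: "finite U" using U(1) finA by (rule finite_subset)
  \<comment> \<open>The factor 2 before \<open>v + w\<close> in the hypotheses leaves room to remove
    \<open>U\<close> and repeat the construction.\<close>
  have "\<exists>V\<subseteq>A - U. card V \<le> v + w \<and> order G < 2 * card (subset_sums G V)"
  proof (rule exists_large_subset_sums[OF fin _ _ _ s(2,3) w])
    show "A - U \<subseteq> carrier G" using A by blast
    show "s + (v + w) \<le> card (A - U)"
      using s(1) U(2) card_Diff_subset[OF finU U(1)] by simp
    fix H assume "subgroup H G" "H \<noteq> carrier G"
    then have "2 * (v + w) < card (A - H)" by (rule spread)
    moreover have "card (A - H) \<le> card (A - U - H) + card U"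
      using finA finU by (intro order_trans[OF card_mono card_Un_le]) auto
    ultimately show "v + w < card (A - U - H)" using U(2) by simp
  qed
  then obtain V where V: "V \<subseteq> A - U" "order G < 2 * card (subset_sums G V)"
    by blast
  let ?S = "subset_sums G U" and ?T = "subset_sums G V"
  have Uc: "U \<subseteq> carrier G" and Vc: "V \<subseteq> carrier G" using U V A by auto
  note Sc = subset_sums_closed[OF Uc] and Tc = subset_sums_closed[OF Vc]
  have "carrier G \<subseteq> subset_sums G A"
  proof
    fix g assume g: "g \<in> carrier G"
    let ?f = "\<lambda>x. g \<otimes> inv x"
    have inj: "inj_on ?f ?S"
      using g Sc by (auto intro!: inj_onI dest!: inv_eqD simp: subset_iff)
    have "?f ` ?S \<inter> ?T \<noteq> {}"
    proof
      assume "?f ` ?S \<inter> ?T = {}"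
      then have "card (?f ` ?S) + card ?T = card (?f ` ?S \<union> ?T)"
        using finite_subset[OF Sc fin] finite_subset[OF Tc fin] by (simp add: card_Un_disjoint)
      also have "\<dots> \<le> order G"
        unfolding order_def using fin g Sc Tc by (intro card_mono) auto
      finally show False using U(3) V(2) inj by (simp add: card_image)
    qed
    then obtain x where x: "x \<in> ?S" "g \<otimes> inv x \<in> ?T" by blast
    then have "x \<otimes> (g \<otimes> inv x) \<in> subset_sums G (U \<union> V)"
      using V by (intro subset_sums_mult Uc Vc) auto
    moreover have "x \<otimes> (g \<otimes> inv x) = g"
    proof -
      have "x \<in> carrier G" using x(1) Sc by blast
      with g have "x \<otimes> (g \<otimes> inv x) = g \<otimes> (x \<otimes> inv x)" by (intro m_lcomm) auto
      with g \<open>x \<in> carrier G\<close> show ?thesis by simp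
    qed
    ultimately show "g \<in> subset_sums G A"
      using subset_sums_mono[of "U \<union> V" A] U V by auto
  qed
  then show ?thesis using subset_sums_closed[OF A] by blast
qed

section \<open>Products of two distinct elements filling a subgroup\<close>

text \<open>Two distinct involutions generate a Klein four-group, and Lagrange applies.\<close>

lemma four_dvd_order:
  assumes "u \<in> carrier G" "v \<in> carrier G" "u \<otimes> u = \<one>" "v \<otimes> v = \<one>"
    and "u \<noteq> \<one>" "v \<noteq> \<one>" "u \<noteq> v"
  shows "4 dvd order G"
proof -
  let ?K = "{\<one>, u, v, u \<otimes> v}"
  have inv: "inv u = u" "inv v = v"
    using assms by (simp_all add: inv_equality)
  have "u \<otimes> (u \<otimes> v) = v"
    using assms by (simp flip: m_assoc)
  moreover have "v \<otimes> u = u \<otimes> v"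
    using assms by (simp add: m_comm)
  moreover from this have "v \<otimes> (u \<otimes> v) = u"
    using assms by (metis m_assoc r_one)
  moreover have "u \<otimes> v \<otimes> x = u \<otimes> (v \<otimes> x)" if "x \<in> carrier G" for x
    using assms that by (simp add: m_assoc)
  ultimately have "subgroup ?K G"
    by (intro subgroupI) (use assms inv in \<open>auto simp: inv_mult\<close>)
  then have "card ?K dvd order G"
    using lagrange by (metis dvd_triv_right)
  moreover have "u \<otimes> v \<noteq> \<one>"
    using assms inv by (metis inv_equality)
  moreover have "u \<otimes> v \<noteq> u" "u \<otimes> v \<noteq> v"
    using assms by simp_all
  ultimately have "card ?K dvd order G" "card ?K = 4"
    using assms by (simp_all add: card_insert_if eq_commute[of _ "u \<otimes> v"] eq_commute[of \<one>])
  then show ?thesis by simp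
qed

text \<open>Quotients of two square roots of \<open>x\<close> square to the identity, so three
  distinct roots \<open>a\<close>, \<open>b\<close>, \<open>c\<close> yield the distinct involutions
  \<open>a \<otimes> inv b\<close> and \<open>a \<otimes> inv c\<close>.\<close>

lemma card_square_roots_le:
  assumes "finite (carrier G)" "\<not> 4 dvd order G"
  shows "card {a \<in> carrier G. a \<otimes> a = x} \<le> 2"
proof (rule ccontr)
  let ?R = "{a \<in> carrier G. a \<otimes> a = x}"
  assume "\<not> ?thesis"
  then have "3 \<le> card ?R" by simp
  then obtain T where "T \<subseteq> ?R" "card T = 3"
    by (rule obtain_subset_with_card_n)
  then obtain a b c where R: "a \<in> ?R" "b \<in> ?R" "c \<in> ?R" and neq: "a \<noteq> b" "a \<noteq> c" "b \<noteq> c"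
    by (auto simp: card_3_iff)
  have sq: "(a \<otimes> inv y) \<otimes> (a \<otimes> inv y) = \<one>" if "y \<in> ?R" for y
  proof -
    have y: "y \<in> carrier G" and a: "a \<in> carrier G" and eq: "a \<otimes> a = y \<otimes> y"
      using that R by auto
    have "(a \<otimes> inv y) \<otimes> (a \<otimes> inv y) = (a \<otimes> a) \<otimes> (inv y \<otimes> inv y)"
      using a y by (simp add: m_ac)
    also have "\<dots> = (y \<otimes> y) \<otimes> inv (y \<otimes> y)"
      using y by (simp add: eq inv_mult)
    finally show ?thesis using y by simp
  qed
  have one: "a \<otimes> inv y \<noteq> \<one>" if "y \<in> carrier G" "a \<noteq> y" for y
    using that R(1) by (metis (mono_tags, lifting) inv_closed inv_equality inv_inv mem_Collect_eq)
  have "4 dvd order G"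
    by (rule four_dvd_order[of "a \<otimes> inv b" "a \<otimes> inv c"]) (use R neq sq one in \<open>auto dest: inv_eqD\<close>)
  with assms(2) show False by simp
qed

text \<open>Pigeonhole in \<open>H\<close>: the set of all \<open>x \<otimes> inv b\<close> with
  \<open>b\<close> in \<open>B\<close> meets \<open>B\<close> in more than two elements. At most two
  of these are square roots of \<open>x\<close>; any other writes \<open>x\<close> as a product of
  two distinct elements of \<open>B\<close>.\<close>

lemma subset_sums_eq_subgroup:
  assumes fin: "finite (carrier G)" and "\<not> 4 dvd order G"
    and H: "subgroup H G" and B: "B \<subseteq> H" "card H + 2 < 2 * card B"
  shows "subset_sums G B = H"
proof
  show "subset_sums G B \<subseteq> H"
    using H B(1) by (rule subset_sums_subset_subgroup)
  have Hc: "H \<subseteq> carrier G" using H by (rule subgroup.subset)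
  have finH: "finite H" "finite B"
    using Hc B(1) fin finite_subset by metis+
  show "H \<subseteq> subset_sums G B"
  proof
    fix x assume x: "x \<in> H"
    let ?f = "\<lambda>b. x \<otimes> inv b"
    have inj: "inj_on ?f B"
      using x B Hc by (auto intro!: inj_onI dest!: inv_eqD simp: subset_iff)
    have "?f ` B \<subseteq> H"
      using x B(1) subgroup.m_closed[OF H] subgroup.m_inv_closed[OF H] by blast
    then have "card (?f ` B \<union> B) \<le> card H"
      using B(1) finH by (intro card_mono) auto
    then have "2 < card (?f ` B \<inter> B)"
      using card_Un_Int[of "?f ` B" B] finH B(2) inj by (simp add: card_image)
    moreover have "card {a \<in> carrier G. a \<otimes> a = x} \<le> 2"
      by (rule card_square_roots_le) fact+
    ultimately have "\<not> ?f ` B \<inter> B \<subseteq> {a \<in> carrier G. a \<otimes> a = x}"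
      using fin card_mono[of "{a \<in> carrier G. a \<otimes> a = x}" "?f ` B \<inter> B"] by force
    then obtain b where b: "b \<in> B" "x \<otimes> inv b \<in> B" and sq: "(x \<otimes> inv b) \<otimes> (x \<otimes> inv b) \<noteq> x"
      using B(1) Hc by blast
    have c: "x \<in> carrier G" "b \<in> carrier G" using x b B Hc by auto
    have eq: "x \<otimes> inv b \<otimes> b = x" using c by (simp add: m_assoc)
    with sq have "x \<otimes> inv b \<noteq> b" by metis
    with eq c have "finprod G (\<lambda>a. a) {x \<otimes> inv b, b} = x" by simp
    with b show "x \<in> subset_sums G B"
      unfolding subset_sums_def by (intro CollectI exI[of _ "{x \<otimes> inv b, b}"]) auto
  qed
qed

section \<open>Subset sums modulo a subgroup of prime index\<close>

text \<open>A union of cosets of \<open>H\<close> other than \<open>G\<close> is not stable under any \<open>x \<notin> H\<close>, as \<open>H\<close> is maximal; so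
  every further element of \<open>D\<close> contributes a new coset.\<close>

lemma card_subset_sums_prime_index:
  assumes fin: "finite (carrier G)" and H: "subgroup H G"
    and m: "Factorial_Ring.prime m" "order G = m * card H"
    and B: "B \<subseteq> H" "subset_sums G B = H"
    and D: "D \<subseteq> carrier G - H" "card D < m"
  shows "(card D + 1) * card H \<le> card (subset_sums G (B \<union> D))"
proof -
  have Hc: "H \<subseteq> carrier G" using H by (rule subgroup.subset)
  have "finite D" using D(1) fin by (meson Diff_subset finite_subset)
  \<comment> \<open>The induction carries, besides the count, a nonempty union \<open>T\<close> of
    cosets of \<open>H\<close>, starting from \<open>T = H\<close>.\<close>
  then have "\<exists>T\<subseteq>subset_sums G (B \<union> D). T \<noteq> {} \<and> (\<forall>h\<in>H. T #> h = T) \<and> (card D + 1) * card H \<le> card T"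
    using D
  proof (induction D rule: finite_induct)
    case empty
    have "\<forall>h\<in>H. H #> h = H"
      using coset_join2 H Hc by blast
    then show ?case
      using B(2) subgroup.one_closed[OF H] by (intro exI[of _ H]) auto
  next
    case (insert x D)
    then have "card D < m" "D \<subseteq> carrier G - H" by auto
    with insert.IH obtain T where T: "T \<subseteq> subset_sums G (B \<union> D)" "T \<noteq> {}" "\<forall>h\<in>H. T #> h = T"
      "(card D + 1) * card H \<le> card T"
      by blast
    have BD: "B \<union> D \<subseteq> carrier G" using B Hc insert.prems by blast
    have Tc: "T \<subseteq> carrier G" using T(1) subset_sums_closed[OF BD] by blast
    have finT: "finite T" using Tc fin by (rule finite_subset)
    have x: "x \<in> carrier G" "x \<notin> H" "x \<notin> B" using insert.prems B by auto
    have xs: "x \<in> subset_sums G {x}"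
      using x subset_subset_sums[of "{x}"] by auto
    have T': "T \<union> (T #> x) \<subseteq> subset_sums G (B \<union> insert x D)"
      using subset_sums_mult[OF BD, of "{x}" _ x] xs x insert.hyps T(1)
        subset_sums_mono[of "B \<union> D" "B \<union> insert x D"]
      by (auto simp: r_coset_def)
    have Txc: "T #> x \<subseteq> carrier G" using Tc x(1) by (rule r_coset_subset_G)
    have per: "(T \<union> (T #> x)) #> h = T \<union> (T #> x)" if "h \<in> H" for h
    proof -
      have "h \<in> carrier G" using that Hc by blast
      have "(T #> x) #> h = (T #> h) #> x"
        using Tc x(1) \<open>h \<in> carrier G\<close> by (simp add: coset_mult_assoc m_comm)
      moreover have "(T \<union> (T #> x)) #> h = (T #> h) \<union> ((T #> x) #> h)"
        by (auto simp: r_coset_def)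
      ultimately show ?thesis using T(3) that by simp
    qed
    have "(card D + 2) * card H \<le> card (T \<union> (T #> x))"
    proof (cases "T #> x \<subseteq> T")
      \<comment> \<open>Here the stabilizer of \<open>T\<close> contains \<open>H\<close> and
        \<open>x\<close>, so it is \<open>G\<close> and \<open>T = G\<close>; the count holds since
        \<open>card D + 2 \<le> m\<close>.\<close>
      case True
      let ?K = "{g \<in> carrier G. T #> g = T}"
      have "x \<in> ?K" using r_coset_eqI[OF finT Tc x(1) True] x(1) by simp
      moreover have "H \<subseteq> ?K" using T(3) Hc by blast
      ultimately have K: "?K = carrier G"
        using prime_index_maximal[OF fin H subgroup_stabilizer[OF finT Tc] _ m] x(2) by blast
      obtain t where t: "t \<in> T" using T(2) by blast
      have "carrier G \<subseteq> T"
      proof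
        fix g assume g: "g \<in> carrier G"
        then have k: "inv t \<otimes> g \<in> carrier G" using t Tc by auto
        have "t \<otimes> (inv t \<otimes> g) \<in> T #> (inv t \<otimes> g)"
          using t unfolding r_coset_def by blast
        also have "\<dots> = T" using k K by blast
        finally show "g \<in> T" using t Tc g by (auto simp: m_assoc[symmetric] subset_iff)
      qed
      then have "order G \<le> card (T \<union> (T #> x))"
        unfolding order_def using finT by (intro card_mono) (auto simp: finite_r_coset)
      moreover have "(card D + 2) * card H \<le> m * card H"
        using insert by (intro mult_right_mono) auto
      ultimately show ?thesis using m(2) by simp
    next
      case False
      \<comment> \<open>The whole coset of \<open>y\<close> is new, because \<open>T\<close> and its
        enlargement are both stable under \<open>H\<close>.\<close>
      then obtain y where y: "y \<in> T #> x" "y \<notin> T" by blast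
      have yc: "y \<in> carrier G" using y(1) Txc by blast
      have "H #> y \<subseteq> T \<union> (T #> x)"
      proof
        fix z assume "z \<in> H #> y"
        then obtain h where h: "h \<in> H" "z = h \<otimes> y" by (auto simp: r_coset_def)
        then have "z = y \<otimes> h" using yc Hc by (auto simp: m_comm)
        then have "z \<in> (T \<union> (T #> x)) #> h"
          using y(1) unfolding r_coset_def by blast
        then show "z \<in> T \<union> (T #> x)" using per[OF h(1)] by simp
      qed
      moreover have "T \<inter> (H #> y) = {}"
      proof (rule ccontr)
        assume "T \<inter> (H #> y) \<noteq> {}"
        then obtain h where h: "h \<in> H" "h \<otimes> y \<in> T" by (auto simp: r_coset_def)
        have hc: "h \<in> carrier G" using h Hc by blast
        have "h \<otimes> y \<otimes> inv h \<in> T #> inv h"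
          using h(2) unfolding r_coset_def by blast
        also have "T #> inv h = T"
          using T(3) subgroup.m_inv_closed[OF H h(1)] by blast
        also have "h \<otimes> y \<otimes> inv h = y"
          using hc yc by (metis inv_closed m_assoc m_comm r_inv r_one)
        finally show False using y(2) by simp
      qed
      ultimately have "card T + card (H #> y) \<le> card (T \<union> (T #> x))"
        using finT finite_subset[OF Hc fin]
        by (subst card_Un_disjoint[symmetric]) (auto simp: finite_r_coset intro!: card_mono)
      moreover have "card (H #> y) = card H" using Hc yc by (rule card_r_coset)
      ultimately show ?thesis using T(4) by simp
    qed
    then show ?case
      using T' T(2) per insert.hyps by (intro exI[of _ "T \<union> (T #> x)"]) auto
  qed
  then obtain T where "T \<subseteq> subset_sums G (B \<union> D)" "(card D + 1) * card H \<le> card T"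
    by blast
  moreover have "finite (subset_sums G (B \<union> D))"
    by (rule finite_subset[OF subset_sums_closed fin]) (use B Hc D in auto)
  ultimately show ?thesis by (meson card_mono order_trans)
qed

text \<open>Choosing \<open>m - 1\<close> elements outside \<open>H\<close> would give at least
  \<open>m * card H = order G\<close> subset sums, making \<open>A\<close> complete.\<close>

lemma card_diff_less_prime_index:
  assumes fin: "finite (carrier G)" and H: "subgroup H G"
    and m: "Factorial_Ring.prime m" "order G = m * card H"
    and A: "A \<subseteq> carrier G" "subset_sums G (A \<inter> H) = H" "subset_sums G A \<noteq> carrier G"
  shows "card (A - H) < m - 1"
proof (rule ccontr)
  assume "\<not> ?thesis"
  then have "m - 1 \<le> card (A - H)" by simp
  then obtain D where D: "D \<subseteq> A - H" "card D = m - 1"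
    by (rule obtain_subset_with_card_n)
  have "0 < m" using m(1) by (rule prime_gt_0_nat)
  have sub: "subset_sums G A \<subseteq> carrier G" using A(1) by (rule subset_sums_closed)
  have "(card D + 1) * card H \<le> card (subset_sums G (A \<inter> H \<union> D))"
    by (rule card_subset_sums_prime_index[OF fin H m]) (use A D \<open>0 < m\<close> in auto)
  also have "\<dots> \<le> card (subset_sums G A)"
    using D by (intro card_mono finite_subset[OF sub fin] subset_sums_mono) auto
  finally have "card (carrier G) \<le> card (subset_sums G A)"
    using D(2) \<open>0 < m\<close> m(2) by (simp add: order_def)
  with A(3) sub fin show False
    using card_seteq by blast
qed

subsection \<open>Large incomplete sets\<close>

lemma incomplete_structure:
  assumes order: "order G = q * N" and q: "0 < q" "1080 * q \<le> N" "\<not> 4 dvd order G"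
    and least: "\<And>r. Factorial_Ring.prime r \<Longrightarrow> r dvd order G \<Longrightarrow> q \<le> r"
    and A: "A \<subseteq> carrier G" "subset_sums G A \<noteq> carrier G" "5 * N \<le> 6 * card A"
  shows "\<exists>H m. subgroup H G \<and> Factorial_Ring.prime m \<and> order G = m * card H \<and> card (A - H) < 2 * q \<and>
           subset_sums G (A \<inter> H) = H"
proof -
  have N: "1080 \<le> N" using q by linarith
  then have "0 < order G" using order q by simp
  then have fin: "finite (carrier G)" using order_gt_0_iff_finite by blast
  have finA: "finite A" using A(1) fin by (rule finite_subset)
  have "\<exists>H. subgroup H G \<and> H \<noteq> carrier G \<and> N + 2 < 2 * card (A \<inter> H)"
  proof (rule ccontr)
    assume none: "\<not> ?thesis"
    \<comment> \<open>Up to rounding, \<open>s + 2 (v + w)\<close> is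
      \<open>4 N / 5 < 5 N / 6\<close>, and \<open>2 (v + w)\<close> is \<open>3 N / 10\<close>,
      less than the \<open>5 N / 6 - N / 2 = N / 3\<close> elements outside a proper subgroup. The
      product \<open>w * s\<close> is at least \<open>N * N / 48\<close>, hence at least
      \<open>22.5 * order G\<close>.\<close>
    define v w s where "v = N div 12 + 1" and "w = N div 15" and "s = N div 2"
    then have bounds: "12 * v \<le> N + 12" "15 * w \<le> N" "2 * s \<le> N"
      "N < 12 * v" "N < 15 * w + 15" "N < 2 * s + 2"
      by presburger+
    have "subset_sums G A = carrier G"
    proof (rule subset_sums_eq_carrier[OF fin A(1), of v w s])
      fix H assume "subgroup H G" "H \<noteq> carrier G"
      then have "2 * card (A \<inter> H) \<le> N + 2" using none by (auto simp: not_less)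
      moreover have "card A = card (A \<inter> H) + card (A - H)"
        using finA by (metis card_Int_Diff add.commute)
      moreover have "2 * (v + w) < a" if "2 * b \<le> N + 2" "card A = b + a" for a b
        using that A(3) N bounds unfolding add_mult_distrib2 by linarith
      ultimately show "2 * (v + w) < card (A - H)" by blast
    next
      show "s + 2 * (v + w) \<le> card A" using A(3) N bounds unfolding add_mult_distrib2 by linarith
      show "0 < s" "s \<le> 6 * v" using N bounds by linarith+
      have "N \<le> 16 * w" "N \<le> 3 * s" using N bounds by linarith+
      then have "N * N \<le> (16 * w) * (3 * s)" by (rule mult_le_mono)
      then have "N * N \<le> 48 * (w * s)" by simp
      moreover have "1080 * (q * N) \<le> N * N" using mult_le_mono1[OF q(2), of N] by simp
      moreover have "0 < q * N" using q(1) N by simp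
      ultimately show "12 * order G < w * s" unfolding order by linarith
    qed
    with A(2) show False by simp
  qed
  then obtain H where H: "subgroup H G" "H \<noteq> carrier G" "N + 2 < 2 * card (A \<inter> H)"
    by blast
  have Hc: "H \<subseteq> carrier G" using H(1) by (rule subgroup.subset)
  have finH: "finite H" using Hc fin by (rule finite_subset)
  obtain m where m: "order G = m * card H" using lagrange[OF H(1)] by metis
  have "m \<noteq> 1" using m H(2) card_subset_eq[OF fin Hc] by (auto simp: order_def)
  have "N < 2 * card H"
    using H(3) card_mono[OF finH, of "A \<inter> H"] by simp
  have m2: "m < 2 * q"
  proof (rule ccontr)
    assume "\<not> m < 2 * q"
    then have "2 * q * card H \<le> m * card H" by (intro mult_le_mono1) simp
    also have "\<dots> = q * N" using m order by simp
    also have "\<dots> < q * (2 * card H)" using \<open>N < 2 * card H\<close> q(1) by simp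
    finally show False by simp
  qed
  obtain r where r: "Factorial_Ring.prime r" "r dvd m"
    using prime_factor_nat[OF \<open>m \<noteq> 1\<close>] by blast
  obtain k where k: "m = r * k" using r(2) by (rule dvdE)
  have "q \<le> r" by (rule least) (use r m in auto)
  \<comment> \<open>The factor \<open>r\<close> is at least \<open>q\<close>, so a cofactor of 2 or
    more would contradict \<open>m < 2 * q\<close>.\<close>
  have "k = 1"
  proof (rule ccontr)
    assume "k \<noteq> 1"
    have "0 < k" using k m \<open>0 < order G\<close> by (auto intro: Nat.gr0I)
    then have "2 \<le> k" using \<open>k \<noteq> 1\<close> by linarith
    then have "q * 2 \<le> r * k" using \<open>q \<le> r\<close> by (intro mult_le_mono)
    with m2 k show False by simp
  qed
  with k r have mp: "Factorial_Ring.prime m" by simp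
  have "q \<le> m" by (rule least[OF mp]) (simp add: m)
  \<comment> \<open>This turns \<open>N + 2 < 2 * card (A \<inter> H)\<close> into the pigeonhole
    condition relative to \<open>card H\<close>.\<close>
  have "card H \<le> N"
  proof -
    have "q * card H \<le> m * card H" using \<open>q \<le> m\<close> by (rule mult_le_mono1)
    also have "\<dots> = q * N" using m order by simp
    finally show ?thesis using q(1) by simp
  qed
  have sums: "subset_sums G (A \<inter> H) = H"
    by (rule subset_sums_eq_subgroup[OF fin q(3) H(1)]) (use H(3) \<open>card H \<le> N\<close> in auto)
  have "card (A - H) < m - 1"
    by (rule card_diff_less_prime_index[OF fin H(1) mp m A(1) sums A(2)])
  with H(1) mp m m2 sums show ?thesis by (intro exI[of _ H] exI[of _ m]) auto
qed

end

section \<open>From the real constants to integer bounds\<close>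

text \<open>From \<open>ln (2 / \<delta>) \<le> 2 / \<delta>\<close> the denominator
  \<open>\<delta>^2 * ln (2 / \<delta>)\<close> is at most \<open>2 * \<delta> \<le> 1 / 3\<close>,
  and 40 divided by this is at least 120.\<close>

lemma C_eps_square_ge:
  assumes "0 < \<delta>" "\<delta> \<le> 1 / 6"
  shows "0 < C_eps \<delta>" "120 \<le> (C_eps \<delta>)\<^sup>2"
proof -
  define l where "l = ln (2 / \<delta>)"
  have "0 < l" using assms by (simp add: l_def field_simps)
  have "l \<le> 2 / \<delta>" using assms unfolding l_def by (intro less_imp_le ln_less_self) simp
  then have "\<delta> * l \<le> 2" using assms by (simp add: field_simps)
  then have "\<delta> * (\<delta> * l) \<le> 1 / 6 * 2" using assms \<open>0 < l\<close> by (intro mult_mono) auto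
  then have "\<delta>\<^sup>2 * l \<le> 1 / 3" by (simp add: power2_eq_square mult.assoc)
  moreover have "0 < \<delta>\<^sup>2 * l" using assms \<open>0 < l\<close> by simp
  ultimately have "120 \<le> 40 / (\<delta>\<^sup>2 * l)" by (simp add: field_simps)
  moreover have "C_eps \<delta> = sqrt (40 / (\<delta>\<^sup>2 * l))" by (simp add: C_eps_def l_def)
  moreover from calculation have "0 < 40 / (\<delta>\<^sup>2 * l)" by linarith
  ultimately show "0 < C_eps \<delta>" "120 \<le> (C_eps \<delta>)\<^sup>2"
    by (simp_all only: real_sqrt_gt_0_iff real_sqrt_pow2 less_imp_le)
qed

theorem theorem2p7:
  fixes G :: "('a, 'b) monoid_scheme" and A :: "'a set"
    and \<delta> :: real and t n :: nat and p :: "nat \<Rightarrow> nat"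
  assumes "0 < \<delta>" and "\<delta> \<le> 1 / 6"
    and "t \<ge> 2"
    and "\<forall>i\<in>{1..t}. Factorial_Ring.prime (p i)"
    and "mono_on {1..t} p"
    and "p 2 \<ge> 3"
    and "n = (\<Prod>i=1..t. p i)"
    and "n \<ge> n_eps \<delta>"
    and "real (p 1) \<le> 1 / (3 * C_eps \<delta>) * sqrt (real n / ln (real n))"
    and "comm_group G"
    and "order G = n"
    and "A \<subseteq> carrier G"
    and "incomplete_subset G A"
    and "real (card A) \<ge> (5 / 6 + \<delta>) * (real n / real (p 1))"
  shows "nice G A \<and>
         (\<exists>H. subgroup H G \<and>
              (\<exists>i\<in>{1..t}. real n / real (card H) = real (p i)) \<and>
              card (A - H) < 3 * p 1 \<and>
              subset_sums G (A \<inter> H) = H)"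
proof -
  interpret comm_group G by fact
  define N where "N = (\<Prod>i=2..t. p i)"
  have prime: "Factorial_Ring.prime (p i)" if "i \<in> {1..t}" for i
    using assms(4) that by blast
  have mono: "p i \<le> p j" if "i \<in> {1..t}" "j \<in> {1..t}" "i \<le> j" for i j
    using assms(5) that by (rule mono_onD)
  have p1: "Factorial_Ring.prime (p 1)" using assms(3) by (intro prime) auto
  have n: "n = p 1 * N"
    using assms(3) unfolding assms(7) N_def
    by (simp add: prod.atLeast_Suc_atMost numeral_2_eq_2)
  have prime_dvd: "\<exists>i\<in>I. r = p i"
    if r: "Factorial_Ring.prime r" "r dvd (\<Prod>i\<in>I. p i)" and I: "I \<subseteq> {1..t}" for r I
  proof -
    have "finite I" using I by (rule finite_subset) simp
    then obtain i where "i \<in> I" "r dvd p i"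
      using r by (auto simp: prime_dvd_prod_iff)
    then show ?thesis
      using r(1) I prime primes_dvd_imp_eq by blast
  qed
  \<comment> \<open>By monotonicity and \<open>p 2 \<ge> 3\<close> only \<open>p 1\<close> can be 2,
    and it occurs once in the product; hence 4 does not divide \<open>n\<close>.\<close>
  have "odd N"
  proof
    assume "even N"
    then obtain i where i: "i \<in> {2..t}" "2 = p i"
      using prime_dvd[of 2 "{2..t}"] unfolding N_def by auto
    then have "p 2 \<le> p i" by (intro mono) auto
    with i(2) assms(6) show False by simp
  qed
  have not4: "\<not> 4 dvd n"
  proof
    assume "4 dvd n"
    moreover have "coprime (2 ^ 2) N"
      using \<open>odd N\<close> by (subst coprime_power_left_iff) simp
    ultimately have "2 * 2 dvd p 1"
      unfolding n by (simp add: coprime_dvd_mult_left_iff)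
    moreover from this have "2 dvd p 1" by (rule dvd_mult_left)
    then have "p 1 = 2" using p1 primes_dvd_imp_eq two_is_prime_nat by metis
    ultimately show False by simp
  qed
  have "N > 0" using \<open>odd N\<close> by (rule odd_pos)
  have p1_pos: "0 < p 1" using p1 by (rule prime_gt_0_nat)
  have "3 \<le> n"
  proof -
    have "p 2 dvd n" unfolding assms(7) using assms(3) by (intro dvd_prodI) auto
    with assms(6) show ?thesis using n \<open>N > 0\<close> p1_pos dvd_imp_le[of "p 2" n] by simp
  qed
  have ln1: "1 \<le> ln (real n)"
  proof -
    have "exp 1 \<le> real n" using exp_le \<open>3 \<le> n\<close> by linarith
    then show ?thesis using \<open>3 \<le> n\<close> by (subst ln_ge_iff) auto
  qed
  \<comment> \<open>Squaring the bound on \<open>p 1\<close> gives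
    \<open>9 C^2 p_1^2 \<le> n / ln n \<le> n = p_1 N\<close>, and
    \<open>9 * 120 = 1080\<close>.\<close>
  have N1080: "1080 * p 1 \<le> N"
  proof -
    note C = C_eps_square_ge[OF assms(1,2)]
    let ?C = "C_eps \<delta>" and ?p = "real (p 1)"
    have "3 * ?C * ?p \<le> sqrt (real n / ln (real n))"
      using assms(9) C(1) by (simp add: field_simps)
    then have "(3 * ?C * ?p)\<^sup>2 \<le> (sqrt (real n / ln (real n)))\<^sup>2"
      using C(1) by (intro power_mono) auto
    also have "\<dots> = real n / ln (real n)" using ln1 by simp
    also have "\<dots> \<le> real n" using ln1 mult_left_mono[of 1 "ln (real n)" "real n"] by (simp add: field_simps)
    finally have "9 * ?C\<^sup>2 * ?p\<^sup>2 \<le> ?p * real N" by (simp add: power_mult_distrib n)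
    moreover have "9 * 120 * ?p\<^sup>2 \<le> 9 * ?C\<^sup>2 * ?p\<^sup>2"
      using C(2) by (intro mult_right_mono) auto
    ultimately have "?p * (1080 * ?p) \<le> ?p * real N" by (simp add: power2_eq_square)
    then have "1080 * ?p \<le> real N" using p1_pos by simp
    then show ?thesis by linarith
  qed
  have A6: "5 * N \<le> 6 * card A"
  proof -
    have "real n / real (p 1) = real N" using p1_pos by (simp add: n)
    then have "(5 / 6 + \<delta>) * real N \<le> real (card A)" using assms(14) by simp
    moreover have "0 \<le> \<delta> * real N" using assms(1) by simp
    ultimately have "5 / 6 * real N \<le> real (card A)" by (simp add: algebra_simps)
    then show ?thesis by linarith
  qed
  have least: "p 1 \<le> r" if r: "Factorial_Ring.prime r" "r dvd order G" for r
  proof -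
    obtain i where "i \<in> {1..t}" "r = p i"
      using prime_dvd[OF r(1), of "{1..t}"] r(2) assms(7,11) by auto
    then show ?thesis using mono[of 1 i] by auto
  qed
  obtain H m where H: "subgroup H G" and m: "Factorial_Ring.prime m" "order G = m * card H"
    and "card (A - H) < 2 * p 1" and sums: "subset_sums G (A \<inter> H) = H"
    using incomplete_structure[of "p 1" N A] n N1080 not4 least p1_pos A6 assms(11-13)
    unfolding complete_subset_def by auto
  have n_m: "n = m * card H" using m(2) assms(11) by simp
  then have "0 < card H" using \<open>3 \<le> n\<close> by (cases "card H") auto
  have "order (G Mod H) = m"
  proof -
    have "card (rcosets\<^bsub>G\<^esub> H) * card H = m * card H" using lagrange[OF H] m(2) by simp
    then show ?thesis using \<open>0 < card H\<close> by (simp add: order_def FactGroup_def)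
  qed
  then have "nice G A" unfolding nice_def using H m(1) sums by blast
  moreover obtain i where i: "i \<in> {1..t}" "m = p i"
    using prime_dvd[OF m(1), of "{1..t}"] n_m assms(7) by auto
  moreover have "real n / real (card H) = real m"
    using n_m \<open>0 < card H\<close> by simp
  moreover have "card (A - H) < 3 * p 1" using \<open>card (A - H) < 2 * p 1\<close> by linarith
  ultimately show ?thesis using H sums by metis
qed

end
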